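(* Let $\widehat{x}\in S$. The following statements hold: (i) If $\vartheta(\widehat{x},\xi,\lambda)=0$ for some $\xi:=(\xi_1,\ldots,\xi_p)\in\prod_{i=1}^{p}\partial f_i(\widehat{x})$ and $\lambda\geq 0_p$, then $\widehat{x}$ is a weak efficient solution for $(P)$. (ii) If $\widehat{x}$ is a weak efficient solution for $(P)$ where the local Farkas–Minkowski constraint qualification (LFMCQ) holds, then there exist $\xi\in\prod_{i=1}^{p}\partial f_i(\widehat{x})$ and $\lambda\geq 0_p$ such that $\vartheta(\widehat{x},\xi,\lambda)=0$.
   Context: Setting: $p\geq 2$, $I:=\{1,\ldots,p\}$; $f_i:\mathbb{R}^n\to\mathbb{R}$ ($i\in I$) are finite-valued convex functions; $T$ is an infinite index set; for each $t\in T$, $g_t:\mathbb{R}^n\to\mathbb{R}\cup\{+\infty\}$ is a lower semicontinuous proper convex function. Problem $(P)$: minimize $f(x):=(f_1(x),\ldots,f_p(x))$ subject to $g_t(x)\le 0$, $t\in T$, with feasible set $S:=\{x\in\mathbb{R}^n\mid g_t(x)\le 0\ \forall t\in T\}$ assumed nonempty. $\widehat{x}\in S$ is a weak efficient solution of $(P)$ if there is no $x\in S$ with $f_i(x)<f_i(\widehat{x})$ for all $i\in I$. For $\lambda\in\mathbb{R}^p$, $\lambda\geq0_p$ means $\lambda_i\ge0$ for all $i\in I$ and $\lambda\neq0_p$. The gap function is $$\vartheta(x,\xi,\lambda):=\sup_{y\in S}\Big\{\sum_{i=1}^{p}\lambda_i\,\xi_i'(x-y)\Big\}\in[-\infty,+\infty]$$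 for $x\in\mathbb{R}^n$, $\xi=(\xi_1,\ldots,\xi_p)\in\prod_{i=1}^p\partial f_i(x)$, and such $\lambda$. $\partial$ is the Fenchel–Moreau subdifferential; $T(\widehat{x}):=\{t\in T\mid g_t(\widehat{x})=0\}$; $G_\ast(\widehat{x})$ is the convex cone containing the origin generated by $\bigcup_{t\in T(\widehat{x})}\partial g_t(\widehat{x})$ (equal to $\{0_n\}$ if this union is empty); $N(S,\widehat{x})$ is the normal cone of convex analysis to $S$ at $\widehat{x}$. LFMCQ holds at $\widehat{x}$ when $N(S,\widehat{x})=G_\ast(\widehat{x})$. *)

theory Defs
  imports "HOL-Analysis.Analysis"
begin

text \<open>Functions with values in \<open>\<real> \<union> {+\<infinity>}\<close> are rendered as \<^typ>\<open>ereal\<close>-valued functions;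
  the value \<open>-\<infinity>\<close> is excluded by \<open>ereal_proper\<close>.\<close>

definition ereal_proper :: "('a \<Rightarrow> ereal) \<Rightarrow> bool" where
  "ereal_proper g \<longleftrightarrow> (\<forall>x. g x \<noteq> -\<infinity>) \<and> (\<exists>x. g x \<noteq> \<infinity>)"

text \<open>Only meaningful for functions that avoid \<open>-\<infinity>\<close>, so that no sum \<open>\<infinity> + (-\<infinity>)\<close> occurs.\<close>

definition ereal_convex :: "('a::real_vector \<Rightarrow> ereal) \<Rightarrow> bool" where
  "ereal_convex g \<longleftrightarrow> (\<forall>x y. \<forall>u\<in>{0<..<1}.
     g ((1 - u) *\<^sub>R x + u *\<^sub>R y) \<le> ereal (1 - u) * g x + ereal u * g y)"

definition lower_semicontinuous :: "('a::topological_space \<Rightarrow> ereal) \<Rightarrow> bool" where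
  "lower_semicontinuous g \<longleftrightarrow> (\<forall>x. g x \<le> Liminf (at x) g)"

text \<open>The Fenchel--Moreau subdifferential, empty where the function is not finite.\<close>

definition subdifferential :: "('a::real_inner \<Rightarrow> ereal) \<Rightarrow> 'a \<Rightarrow> 'a set" where
  "subdifferential g x =
     {v. \<bar>g x\<bar> \<noteq> \<infinity> \<and> (\<forall>y. g x + ereal (v \<bullet> (y - x)) \<le> g y)}"

definition normal_cone :: "'a::real_inner set \<Rightarrow> 'a \<Rightarrow> 'a set" where
  "normal_cone S x = {v. x \<in> S \<and> (\<forall>y\<in>S. v \<bullet> (y - x) \<le> 0)}"

definition feasible_set :: "'t set \<Rightarrow> ('t \<Rightarrow> 'a \<Rightarrow> ereal) \<Rightarrow> 'a set" where
  "feasible_set T g = {x. \<forall>t\<in>T. g t x \<le> 0}"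

definition active_indices :: "'t set \<Rightarrow> ('t \<Rightarrow> 'a \<Rightarrow> ereal) \<Rightarrow> 'a \<Rightarrow> 't set" where
  "active_indices T g x = {t \<in> T. g t x = 0}"

text \<open>A set satisfying \<^const>\<open>convex_cone\<close> is nonempty and hence contains the origin;
  in particular the hull of the empty set is \<open>{0}\<close>.\<close>

definition active_cone :: "'t set \<Rightarrow> ('t \<Rightarrow> 'a::real_inner \<Rightarrow> ereal) \<Rightarrow> 'a \<Rightarrow> 'a set" where
  "active_cone T g x = convex_cone hull (\<Union>t\<in>active_indices T g x. subdifferential (g t) x)"

definition LFMCQ :: "'t set \<Rightarrow> ('t \<Rightarrow> 'a::real_inner \<Rightarrow> ereal) \<Rightarrow> 'a \<Rightarrow> bool" where
  "LFMCQ T g x \<longleftrightarrow> normal_cone (feasible_set T g) x = active_cone T g x"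

definition weak_efficient :: "('p \<Rightarrow> 'a \<Rightarrow> real) \<Rightarrow> 'a set \<Rightarrow> 'a \<Rightarrow> bool" where
  "weak_efficient f S x \<longleftrightarrow> x \<in> S \<and> \<not> (\<exists>y\<in>S. \<forall>i. f i y < f i x)"

definition nonneg_nonzero :: "real ^ 'p \<Rightarrow> bool" where
  "nonneg_nonzero l \<longleftrightarrow> (\<forall>i. 0 \<le> l $ i) \<and> l \<noteq> 0"

definition gap :: "'a::real_inner set \<Rightarrow> 'a \<Rightarrow> ('p::finite \<Rightarrow> 'a) \<Rightarrow> real ^ 'p \<Rightarrow> ereal" where
  "gap S x \<xi> l = (SUP y\<in>S. ereal (\<Sum>i\<in>UNIV. l $ i * (\<xi> i \<bullet> (x - y))))"

end

theory Submission
  imports Defs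
begin

text \<open>
  Part (i) is a summation of subgradient inequalities: if \<open>y \<in> S\<close> were strictly better than \<open>x\<close> in
  every objective, then \<open>\<Sum>i. \<lambda>\<^sub>i (\<xi>\<^sub>i \<bullet> (x - y)) \<ge> \<Sum>i. \<lambda>\<^sub>i (f\<^sub>i x - f\<^sub>i y) > 0\<close>, so the supremum
  defining the gap would be positive.

  Part (ii) rests on one separation of convex sets, in which the multipliers \<open>\<lambda>\<close> and the
  subgradients \<open>\<xi>\<close> appear together.  Every objective receives its own copy \<open>Y\<^sub>i\<close> of the variable.
  The set of all \<open>(Y, r)\<close> with \<open>r\<^sub>i > f\<^sub>i Y\<^sub>i - f\<^sub>i x\<close> for all \<open>i\<close> (a product of shifted strict
  epigraphs) and the set of all \<open>(Y, 0)\<close> with \<open>Y\<^sub>1 = \<dots> = Y\<^sub>p \<in> S\<close> are convex, and weak efficiency of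
  \<open>x\<close> says exactly that they are disjoint.  A separating hyperplane has a normal \<open>(-v, \<lambda>)\<close> such that
  \<open>\<lambda> \<ge> 0\<close>, each \<open>v\<^sub>i\<close> is a subgradient of \<open>\<lambda>\<^sub>i f\<^sub>i\<close> at \<open>x\<close>, and \<open>-\<Sum>i. v\<^sub>i\<close> is normal to \<open>S\<close> at \<open>x\<close>
  (\<open>weak_efficient_imp_multipliers\<close>).  Dividing \<open>v\<^sub>i\<close> by \<open>\<lambda>\<^sub>i\<close> gives \<open>\<xi>\<^sub>i\<close>; where \<open>\<lambda>\<^sub>i = 0\<close>, also
  \<open>v\<^sub>i = 0\<close>, and any subgradient of \<open>f\<^sub>i\<close> serves (\<open>subdifferential_nonempty\<close>).  The normality of
  \<open>-\<Sum>i. \<lambda>\<^sub>i \<xi>\<^sub>i\<close> says that no \<open>y \<in> S\<close> makes the expression in the gap positive, and \<open>y = x\<close> makes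
  it vanish.
\<close>

section \<open>Subgradients and the feasible set\<close>

lemma mem_subdifferential_real_iff:
  "v \<in> subdifferential (\<lambda>y. ereal (h y)) x \<longleftrightarrow> (\<forall>y. v \<bullet> (y - x) \<le> h y - h x)"
  by (auto simp: subdifferential_def algebra_simps)

lemma scaleR_inverse_mem_subdifferential:
  assumes "c > 0" and "\<And>y. v \<bullet> (y - x) \<le> c * (h y - h x)"
  shows "v /\<^sub>R c \<in> subdifferential (\<lambda>y. ereal (h y)) x"
  unfolding mem_subdifferential_real_iff
proof
  fix y
  have "(v \<bullet> (y - x)) / c \<le> h y - h x"
    using assms by (simp add: pos_divide_le_eq mult.commute)
  then show "(v /\<^sub>R c) \<bullet> (y - x) \<le> h y - h x"
    by (simp add: divide_inverse mult.commute)
qed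

lemma convex_feasible_set:
  assumes "\<And>t. t \<in> T \<Longrightarrow> ereal_convex (g t)"
  shows "convex (feasible_set T g)"
  unfolding convex_alt
proof (intro ballI allI impI)
  fix y z :: 'b and u :: real
  assume y: "y \<in> feasible_set T g" and z: "z \<in> feasible_set T g" and u: "0 \<le> u \<and> u \<le> 1"
  show "(1 - u) *\<^sub>R y + u *\<^sub>R z \<in> feasible_set T g"
  proof (cases "u \<in> {0<..<1}")
    case True
    have "g t ((1 - u) *\<^sub>R y + u *\<^sub>R z) \<le> 0" if t: "t \<in> T" for t
    proof -
      have "g t y \<le> 0" "g t z \<le> 0"
        using y z t by (auto simp: feasible_set_def)
      then have "ereal (1 - u) * g t y \<le> 0" "ereal u * g t z \<le> 0"
        using True by (auto simp: ereal_mult_le_0_iff)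
      then have "ereal (1 - u) * g t y + ereal u * g t z \<le> 0"
        using add_mono[of "ereal (1 - u) * g t y" 0 "ereal u * g t z" 0] by simp
      moreover have "g t ((1 - u) *\<^sub>R y + u *\<^sub>R z) \<le> ereal (1 - u) * g t y + ereal u * g t z"
        using assms[OF t] True unfolding ereal_convex_def by blast
      ultimately show ?thesis
        by (rule order_trans[rotated])
    qed
    then show ?thesis
      by (simp add: feasible_set_def)
  next
    case False
    then have "u = 0 \<or> u = 1"
      using u by auto
    then show ?thesis
      using y z by auto
  qed
qed

section \<open>Multipliers by separation\<close>

text \<open>The vector \<open>v i\<close> is a subgradient of \<open>l $ i * f i\<close> rather than of \<open>f i\<close>, because the separating
  hyperplane may be vertical in some coordinates, where \<open>l $ i = 0\<close>.  In such a coordinate the second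
  conclusion forces \<open>v i = 0\<close>, since \<open>v i \<bullet> (y - x)\<close> is then bounded above.  If this happened in
  every coordinate, the normal of the hyperplane would vanish; hence \<open>l \<noteq> 0\<close>.\<close>

lemma weak_efficient_imp_multipliers:
  fixes f :: "'p::finite \<Rightarrow> 'a::euclidean_space \<Rightarrow> real"
  assumes f: "\<And>i. convex_on UNIV (f i)" and S: "convex S" and x: "weak_efficient f S x"
  obtains l v where "nonneg_nonzero l"
    and "\<And>i y. v i \<bullet> (y - x) \<le> l $ i * (f i y - f i x)"
    and "\<And>y. y \<in> S \<Longrightarrow> (\<Sum>i\<in>UNIV. v i) \<bullet> (x - y) \<le> 0"
proof -
  define E :: "(('a ^ 'p) \<times> (real ^ 'p)) set"
    where "E = {(Y, r). \<forall>i. f i (Y $ i) - f i x < r $ i}"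
  define D :: "(('a ^ 'p) \<times> (real ^ 'p)) set" where "D = (\<lambda>y. ((\<chi> i. y), 0)) ` S"
  have xS: "x \<in> S" and no_better: "\<And>y. y \<in> S \<Longrightarrow> \<not> (\<forall>i. f i y < f i x)"
    using x by (auto simp: weak_efficient_def)
  have "convex E"
    unfolding convex_alt
  proof (intro ballI allI impI)
    fix P Q :: "('a ^ 'p) \<times> (real ^ 'p)" and u :: real
    assume P: "P \<in> E" and Q: "Q \<in> E" and u: "0 \<le> u \<and> u \<le> 1"
    obtain Y r Z s where PQ: "P = (Y, r)" "Q = (Z, s)"
      by (metis surj_pair)
    have "f i ((1 - u) *\<^sub>R Y $ i + u *\<^sub>R Z $ i) - f i x < (1 - u) * r $ i + u * s $ i" for i
    proof -
      have "f i ((1 - u) *\<^sub>R Y $ i + u *\<^sub>R Z $ i) \<le> (1 - u) * f i (Y $ i) + u * f i (Z $ i)"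
        using convex_onD[OF f] u by auto
      moreover have "(1 - u) * (f i (Y $ i) - f i x) + u * (f i (Z $ i) - f i x)
          < (1 - u) * r $ i + u * s $ i"
      proof -
        have 1: "f i (Y $ i) - f i x < r $ i" and 2: "f i (Z $ i) - f i x < s $ i"
          using P Q by (auto simp: E_def PQ)
        show ?thesis
        proof (cases "u = 0")
          case False
          then show ?thesis
            using 1 2 u by (intro add_le_less_mono mult_left_mono mult_strict_left_mono) auto
        qed (use 1 in simp)
      qed
      ultimately show ?thesis
        by (simp add: algebra_simps)
    qed
    then show "(1 - u) *\<^sub>R P + u *\<^sub>R Q \<in> E"
      by (simp add: E_def PQ)
  qed
  moreover have "convex D"
    unfolding D_def
  proof (rule convex_linear_image[OF _ S])
    show "linear (\<lambda>y::'a. ((\<chi> i. y), 0) :: ('a ^ 'p) \<times> (real ^ 'p))"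
      by (rule linearI) (simp_all add: vec_eq_iff)
  qed
  moreover have "D \<inter> E = {}"
    using no_better by (fastforce simp: D_def E_def)
  moreover have "D \<noteq> {}"
    using xS by (auto simp: D_def)
  moreover have "(((\<chi> i. x), (\<chi> i. 1)) :: ('a ^ 'p) \<times> (real ^ 'p)) \<in> E"
    by (simp add: E_def)
  ultimately obtain n b where n: "n \<noteq> 0"
    and nD: "\<And>P. P \<in> D \<Longrightarrow> n \<bullet> P \<le> b" and nE: "\<And>P. P \<in> E \<Longrightarrow> b \<le> n \<bullet> P"
    using separating_hyperplane_sets[of D E] by (metis empty_iff)
  obtain a l where al: "n = (a, l)"
    by fastforce
  have below: "(\<Sum>i\<in>UNIV. a $ i \<bullet> y) \<le> b" if "y \<in> S" for y
    using nD[of "((\<chi> i. y), 0)"] that by (simp add: D_def al inner_vec_def)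
  have above: "b \<le> (\<Sum>i\<in>UNIV. a $ i \<bullet> Y i) + (\<Sum>i\<in>UNIV. l $ i * r i)"
    if "\<And>i. f i (Y i) - f i x < r i" for Y r
    using nE[of "((\<chi> i. Y i), (\<chi> i. r i))"] that by (simp add: E_def al inner_vec_def)
  \<comment> \<open>The set \<open>E\<close> is unbounded upwards in every coordinate of \<open>r\<close>, so a negative \<open>l $ i\<close> would push
    the right-hand side of \<open>above\<close> below \<open>b\<close>.\<close>
  have l_nonneg: "0 \<le> l $ i" for i
  proof (rule ccontr)
    assume "\<not> 0 \<le> l $ i"
    then have neg: "l $ i < 0"
      by simp
    define c where "c = (\<Sum>j\<in>UNIV. a $ j \<bullet> x) + (\<Sum>j\<in>UNIV. l $ j)"
    define N where "N = (\<bar>c - b\<bar> + 1) / (- (l $ i))"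
    have N: "N \<ge> 0" "l $ i * N = - (\<bar>c - b\<bar> + 1)"
      using neg by (auto simp: N_def divide_nonneg_neg field_simps)
    have "b \<le> (\<Sum>j\<in>UNIV. a $ j \<bullet> x) + (\<Sum>j\<in>UNIV. l $ j * (1 + (if j = i then N else 0)))"
      using N by (intro above) auto
    also have "(\<Sum>j\<in>UNIV. l $ j * (1 + (if j = i then N else 0)))
        = (\<Sum>j\<in>UNIV. l $ j + (if j = i then l $ i * N else 0))"
      by (rule sum.cong) (auto simp: distrib_left)
    also have "(\<Sum>j\<in>UNIV. a $ j \<bullet> x) + \<dots> = c + l $ i * N"
      by (simp add: c_def sum.distrib)
    finally show False
      using N by simp
  qed
  \<comment> \<open>Letting \<open>r\<close> decrease to \<open>f i (Y i) - f i x\<close> passes from the strict epigraphs to the graphs.\<close>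
  have above_closed: "b \<le> (\<Sum>i\<in>UNIV. a $ i \<bullet> Y i + l $ i * (f i (Y i) - f i x))" for Y
  proof (rule field_le_epsilon)
    fix e :: real
    assume e: "e > 0"
    define L where "L = (\<Sum>i\<in>UNIV. l $ i)"
    have L: "L \<ge> 0"
      using l_nonneg by (simp add: L_def sum_nonneg)
    define d where "d = e / (1 + L)"
    have d: "d > 0" "L * d \<le> e"
      using e L by (auto simp: d_def field_simps)
    have "b \<le> (\<Sum>i\<in>UNIV. a $ i \<bullet> Y i) + (\<Sum>i\<in>UNIV. l $ i * (f i (Y i) - f i x + d))"
      using d by (intro above) auto
    also have "\<dots> = (\<Sum>i\<in>UNIV. a $ i \<bullet> Y i + l $ i * (f i (Y i) - f i x)) + L * d"
      by (simp add: L_def distrib_left sum.distrib sum_distrib_right)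
    finally show "b \<le> (\<Sum>i\<in>UNIV. a $ i \<bullet> Y i + l $ i * (f i (Y i) - f i x)) + e"
      using d by simp
  qed
  have b: "b = (\<Sum>i\<in>UNIV. a $ i \<bullet> x)"
    using below[OF xS] above_closed[of "\<lambda>i. x"] by simp
  \<comment> \<open>Moving only the \<open>i\<close>-th copy of the variable away from \<open>x\<close> isolates the \<open>i\<close>-th summand.\<close>
  have sub: "- (a $ i) \<bullet> (y - x) \<le> l $ i * (f i y - f i x)" for i y
  proof -
    let ?Y = "\<lambda>j. if j = i then y else x"
    have "b \<le> (\<Sum>j\<in>UNIV. a $ j \<bullet> ?Y j + l $ j * (f j (?Y j) - f j x))"
      by (rule above_closed)
    also have "\<dots> = (\<Sum>j\<in>UNIV. a $ j \<bullet> x +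
        (if j = i then a $ i \<bullet> (y - x) + l $ i * (f i y - f i x) else 0))"
      by (rule sum.cong) (auto simp: algebra_simps)
    also have "\<dots> = b + (a $ i \<bullet> (y - x) + l $ i * (f i y - f i x))"
      by (simp add: sum.distrib b)
    finally show ?thesis
      by simp
  qed
  have "l \<noteq> 0"
  proof
    assume l: "l = 0"
    have "a $ i \<bullet> a $ i \<le> 0" for i
      using sub[of i "x - a $ i"] l by simp
    then have "a = 0"
      by (metis inner_gt_zero_iff not_le vec_eq_iff zero_index)
    then show False
      using n l by (simp add: al zero_prod_def)
  qed
  show thesis
  proof (rule that[of l "\<lambda>i. - (a $ i)"])
    show "nonneg_nonzero l"
      using l_nonneg \<open>l \<noteq> 0\<close> by (simp add: nonneg_nonzero_def)
    show "- (a $ i) \<bullet> (y - x) \<le> l $ i * (f i y - f i x)" for i y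
      by (rule sub)
    show "(\<Sum>i\<in>UNIV. - (a $ i)) \<bullet> (x - y) \<le> 0" if "y \<in> S" for y
      using below[OF that] b
      by (simp add: sum_negf inner_diff_right inner_sum_left)
  qed
qed

text \<open>A one-objective problem over the feasible set \<open>{x}\<close> is solved by \<open>x\<close>, and its only multiplier
  is positive.\<close>

lemma subdifferential_nonempty:
  fixes h :: "'a::euclidean_space \<Rightarrow> real"
  assumes "convex_on UNIV h"
  shows "subdifferential (\<lambda>y. ereal (h y)) x \<noteq> {}"
proof -
  have "weak_efficient (\<lambda>_::unit. h) {x} x"
    by (simp add: weak_efficient_def)
  then obtain l :: "real ^ unit" and v where l: "nonneg_nonzero l"
    and v: "\<And>i y. v i \<bullet> (y - x) \<le> l $ i * (h y - h x)"
    by (rule weak_efficient_imp_multipliers[OF assms convex_singleton]) blast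
  have "l $ () > 0"
    using l by (auto simp: nonneg_nonzero_def vec_eq_iff less_le)
  then have "v () /\<^sub>R l $ () \<in> subdifferential (\<lambda>y. ereal (h y)) x"
    using v by (rule scaleR_inverse_mem_subdifferential)
  then show ?thesis
    by blast
qed

section \<open>The gap function and weak efficiency\<close>

lemma gap_eq_0_iff:
  assumes "x \<in> S"
  shows "gap S x \<xi> l = 0 \<longleftrightarrow> (\<forall>y\<in>S. (\<Sum>i\<in>UNIV. l $ i * (\<xi> i \<bullet> (x - y))) \<le> 0)"
proof -
  have "0 \<le> gap S x \<xi> l"
    unfolding gap_def by (rule SUP_upper2[OF assms]) (simp add: zero_ereal_def)
  then have "gap S x \<xi> l = 0 \<longleftrightarrow> gap S x \<xi> l \<le> 0"
    by auto
  then show ?thesis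
    by (simp add: gap_def SUP_le_iff)
qed

lemma gap_eq_0_imp_weak_efficient:
  assumes x: "x \<in> S" and \<xi>: "\<And>i. \<xi> i \<in> subdifferential (\<lambda>y. ereal (f i y)) x"
    and l: "nonneg_nonzero l" and gap: "gap S x \<xi> l = 0"
  shows "weak_efficient f S x"
proof -
  have False if y: "y \<in> S" and better: "\<And>i. f i y < f i x" for y
  proof -
    obtain k where k: "l $ k > 0"
      using l by (auto simp: nonneg_nonzero_def vec_eq_iff less_le)
    have "0 < (\<Sum>i\<in>UNIV. l $ i * (f i x - f i y))"
    proof (rule sum_pos2)
      show "0 < l $ k * (f k x - f k y)"
        using k better[of k] by simp
      show "0 \<le> l $ i * (f i x - f i y)" for i
        using l better[of i] by (simp add: nonneg_nonzero_def)
    qed auto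
    also have "\<dots> \<le> (\<Sum>i\<in>UNIV. l $ i * (\<xi> i \<bullet> (x - y)))"
    proof (rule sum_mono)
      fix i
      have "\<xi> i \<bullet> (y - x) \<le> f i y - f i x"
        using \<xi>[of i] by (simp add: mem_subdifferential_real_iff)
      then have "f i x - f i y \<le> \<xi> i \<bullet> (x - y)"
        by (simp add: inner_diff_right)
      then show "l $ i * (f i x - f i y) \<le> l $ i * (\<xi> i \<bullet> (x - y))"
        using l by (intro mult_left_mono) (auto simp: nonneg_nonzero_def)
    qed
    also have "\<dots> \<le> 0"
      using gap y by (simp add: gap_eq_0_iff[OF x])
    finally show False
      by simp
  qed
  then show ?thesis
    using x by (auto simp: weak_efficient_def)
qed

lemma weak_efficient_imp_gap_eq_0:
  fixes f :: "'p::finite \<Rightarrow> 'a::euclidean_space \<Rightarrow> real"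
  assumes f: "\<And>i. convex_on UNIV (f i)" and S: "convex S" and x: "weak_efficient f S x"
  obtains \<xi> l where "\<And>i. \<xi> i \<in> subdifferential (\<lambda>y. ereal (f i y)) x"
    and "nonneg_nonzero l" and "gap S x \<xi> l = 0"
proof -
  obtain l v where l: "nonneg_nonzero l"
    and v: "\<And>i y. v i \<bullet> (y - x) \<le> l $ i * (f i y - f i x)"
    and normal: "\<And>y. y \<in> S \<Longrightarrow> (\<Sum>i\<in>UNIV. v i) \<bullet> (x - y) \<le> 0"
    by (rule weak_efficient_imp_multipliers[OF f S x]) blast
  have "\<exists>w. w \<in> subdifferential (\<lambda>y. ereal (f i y)) x \<and> v i = l $ i *\<^sub>R w" for i
  proof (cases "l $ i = 0")
    case True
    have "v i \<bullet> v i \<le> 0"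
      using v[of i "x + v i"] True by simp
    then have "v i = 0"
      by (metis inner_gt_zero_iff not_le)
    then show ?thesis
      using True subdifferential_nonempty[OF f[of i], of x] by auto
  next
    case False
    then have pos: "l $ i > 0"
      using l by (auto simp: nonneg_nonzero_def less_le)
    then have "v i /\<^sub>R l $ i \<in> subdifferential (\<lambda>y. ereal (f i y)) x"
      using v by (rule scaleR_inverse_mem_subdifferential)
    moreover have "v i = l $ i *\<^sub>R (v i /\<^sub>R l $ i)"
      using pos by simp
    ultimately show ?thesis
      by blast
  qed
  then obtain \<xi> where \<xi>: "\<And>i. \<xi> i \<in> subdifferential (\<lambda>y. ereal (f i y)) x"
    and v_eq: "\<And>i. v i = l $ i *\<^sub>R \<xi> i"
    by metis
  have "x \<in> S"
    using x by (simp add: weak_efficient_def)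
  then have "gap S x \<xi> l = 0"
    using normal by (simp add: gap_eq_0_iff v_eq inner_sum_left)
  with \<xi> l show thesis
    by (rule that)
qed

theorem theorem4:
  fixes f :: "'p::finite \<Rightarrow> real ^ 'n \<Rightarrow> real"
    and T :: "'t set"
    and g :: "'t \<Rightarrow> real ^ 'n \<Rightarrow> ereal"
    and x :: "real ^ 'n"
  assumes "CARD('p) \<ge> 2"
    and "\<And>i. convex_on UNIV (f i)"
    and "infinite T"
    and "\<And>t. t \<in> T \<Longrightarrow> ereal_proper (g t)"
    and "\<And>t. t \<in> T \<Longrightarrow> ereal_convex (g t)"
    and "\<And>t. t \<in> T \<Longrightarrow> lower_semicontinuous (g t)"
    and "feasible_set T g \<noteq> {}"
    and "x \<in> feasible_set T g"
  shows "((\<exists>\<xi> l. (\<forall>i. \<xi> i \<in> subdifferential (\<lambda>y. ereal (f i y)) x) \<and> nonneg_nonzero l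
             \<and> gap (feasible_set T g) x \<xi> l = 0)
          \<longrightarrow> weak_efficient f (feasible_set T g) x)
       \<and> (weak_efficient f (feasible_set T g) x \<and> LFMCQ T g x
          \<longrightarrow> (\<exists>\<xi> l. (\<forall>i. \<xi> i \<in> subdifferential (\<lambda>y. ereal (f i y)) x) \<and> nonneg_nonzero l
                 \<and> gap (feasible_set T g) x \<xi> l = 0))"
proof (intro conjI impI)
  assume "\<exists>\<xi> l. (\<forall>i. \<xi> i \<in> subdifferential (\<lambda>y. ereal (f i y)) x) \<and> nonneg_nonzero l
    \<and> gap (feasible_set T g) x \<xi> l = 0"
  then show "weak_efficient f (feasible_set T g) x"
    using gap_eq_0_imp_weak_efficient[OF assms(8)] by blast
next
  assume "weak_efficient f (feasible_set T g) x \<and> LFMCQ T g x"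
  moreover have "convex (feasible_set T g)"
    using assms(5) by (rule convex_feasible_set)
  ultimately show "\<exists>\<xi> l. (\<forall>i. \<xi> i \<in> subdifferential (\<lambda>y. ereal (f i y)) x) \<and> nonneg_nonzero l
    \<and> gap (feasible_set T g) x \<xi> l = 0"
    using weak_efficient_imp_gap_eq_0[of f "feasible_set T g" x, OF assms(2)] by metis
qed

end
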